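(* Let $N\ge3$, let $\mathcal P^0\subset\mathbb R^{N-1}$ be a bounded polyhedron containing the true partworth $\mathbf v^*=(v_1^*,\dots,v_{N-1}^* )^\top$, let $\mathcal B^0$ be its minimum enclosing ball with radius $r(\mathcal B^0)>0$, and let $\mathcal P^{k}$ be generated by the coordinate-wise polyhedral method (CPM) described in the context. Put $v_N^*:=1-\sum_{i=1}^{N-1}v_i^*$ and $v^*_{\min}:=\min_{i\in\{1,\dots,N\}}|v_i^*|$, and assume $v^*_{\min}>0$. If $k\ge0$ is an integer with $$k\ \ge\ \left\lceil\frac{2\,[\log v^*_{\min}-\log(2(N-1)r(\mathcal B^0))]}{\log(N-2)-\log(N-1)}\right\rceil ,$$ (i.e. after that many major iterations, equivalently $k(N-1)$ queries), then for every $\mathbf v\in\mathcal P^{k+1}$, writing $R\mathbf v=(v_1,\dots,v_N)^\top$, one has $v_iv_i^*\ge 0$ for all $i=1,\dots,N$.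
   Context: The recovery mapping is $R:\mathbb R^{N-1}\to\mathbb R^N$, $R\mathbf y=(\mathbf y,\,1-\mathbf e^\top\mathbf y)$, with $\mathbf e$ the all-ones vector. A decision maker has true utility $u^*(\mathbf x)=(R\mathbf v^* )^\top\mathbf x$ on $\mathbb R^N$ with unknown $\mathbf v^*\in\mathbb R^{N-1}$, and answers comparisons without error. The minimum enclosing ball (MEB) of a bounded set is the closed Euclidean ball of smallest radius containing it. CPM: start from $\mathcal P^0$. For $k=0,1,2,\dots$ (run without a stopping rule; each $k$ is one major iteration): (1) let $\mathcal B^k$ be the MEB of $\mathcal P^k$, with center $\mathbf c^k$ and radius $r(\mathcal B^k)$; (2) choose an arbitrary orthonormal basis $\boldsymbol\alpha^{k,1},\dots,\boldsymbol\alpha^{k,N-1}$ of $\mathbb R^{N-1}$ and put $\mathcal P^{k,0}=\mathcal P^k$; (3) for $i=1,\dots,N-1$: present a query $(\mathbf x^{A},\mathbf x^{B})\in\mathbb R^N\times\mathbb R^N$ with separating hyperplane $\{\mathbf v:(\boldsymbol\alpha^{k,i})^\top(\mathbf v-\mathbf c^k)=0\}$, namely such that for some $\gamma>0$, $x^A_N-x^B_N=-\gamma(\boldsymbol\alpha^{k,i})^\top\mathbf c^k$ and $x^A_j-x^B_j=(x^A_N-x^B_N)+\gamma\alpha^{k,i}_j$ for $j=1,\dots,N-1$ (so that $(R\mathbf v)^\top(\mathbf x^A-\mathbf x^B)=\gamma(\boldsymbol\alpha^{k,i})^\top(\mathbf v-\mathbf c^k)$ for all $\mathbf v$); set $\mu^{k,i}=-1$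 if $(R\mathbf v^* )^\top\mathbf x^A\ge(R\mathbf v^* )^\top\mathbf x^B$ and $\mu^{k,i}=1$ otherwise; update $$\mathcal P^{k,i}=\mathcal P^{k,i-1}\cap\{\mathbf v\in\mathbb R^{N-1}:\mu^{k,i}(R\mathbf v)^\top(\mathbf x^A-\mathbf x^B)\le 0\};$$ (4) set $\mathcal P^{k+1}=\mathcal P^{k,N-1}$. *)

theory Defs
  imports "HOL-Analysis.Analysis"
begin

text \<open>Throughout, the type \<open>'n\<close> has \<open>N - 1\<close> elements, so that \<open>\<real>\<^sup>N\<^sup>-\<^sup>1\<close> is \<open>real ^ 'n\<close> and \<open>\<real>\<^sup>N\<close> is
  \<open>real ^ 'n option\<close>: the index \<open>Some j\<close> stands for one of the coordinates \<open>1, \<dots>, N - 1\<close>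
  and \<open>None\<close> for the last coordinate \<open>N\<close>.\<close>

definition recovery :: "real ^ 'n \<Rightarrow> real ^ 'n option" where
  "recovery y = (\<chi> i. case i of Some j \<Rightarrow> y $ j | None \<Rightarrow> 1 - (\<Sum>j\<in>UNIV. y $ j))"

definition utility :: "real ^ 'n \<Rightarrow> real ^ 'n option \<Rightarrow> real" where
  "utility v x = recovery v \<bullet> x"

definition v_min :: "real ^ 'n \<Rightarrow> real" where
  "v_min v = Min (range (\<lambda>i. \<bar>recovery v $ i\<bar>))"

text \<open>Radius \<open>0\<close> is allowed, since the polyhedra may shrink to a point.\<close>

definition is_MEB :: "'a::euclidean_space set \<Rightarrow> 'a \<Rightarrow> real \<Rightarrow> bool" where
  "is_MEB S c r \<longleftrightarrow> 0 \<le> r \<and> S \<subseteq> cball c r \<and> (\<forall>c' r'. 0 \<le> r' \<and> S \<subseteq> cball c' r' \<longrightarrow> r \<le> r')"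

definition orthonormal_basis :: "(nat \<Rightarrow> real ^ 'n) \<Rightarrow> bool" where
  "orthonormal_basis \<alpha> \<longleftrightarrow>
     (\<forall>i\<in>{1..CARD('n)}. \<forall>j\<in>{1..CARD('n)}. \<alpha> i \<bullet> \<alpha> j = (if i = j then 1 else 0)) \<and>
     span (\<alpha> ` {1..CARD('n)}) = UNIV"

definition is_query ::
  "real ^ 'n \<Rightarrow> real ^ 'n \<Rightarrow> real ^ 'n option \<Rightarrow> real ^ 'n option \<Rightarrow> bool" where
  "is_query \<alpha> c xA xB \<longleftrightarrow>
     (\<exists>\<gamma>>0. xA $ None - xB $ None = - \<gamma> * (\<alpha> \<bullet> c) \<and>
        (\<forall>j. xA $ Some j - xB $ Some j = (xA $ None - xB $ None) + \<gamma> * \<alpha> $ j))"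

definition answer :: "real ^ 'n \<Rightarrow> real ^ 'n option \<Rightarrow> real ^ 'n option \<Rightarrow> real" where
  "answer vstar xA xB = (if utility vstar xA \<ge> utility vstar xB then -1 else 1)"

text \<open>A run of the method, for a decision maker with true partworth \<open>vstar\<close>, from \<open>P0\<close>.
  In major iteration \<open>k\<close>, \<open>P k\<close> is the current set with minimum enclosing ball
  \<open>cball (c k) (r k)\<close>, and, for \<open>i = 1, \<dots>, N - 1\<close>, \<open>xA k i\<close> and \<open>xB k i\<close> are the alternatives
  in query \<open>i\<close> and \<open>Q k i\<close> is the set obtained from its answer. The choices the method leaves
  open (basis and queries) are left open here.\<close>

definition cpm_run ::
  "real ^ 'n \<Rightarrow> (real ^ 'n) set \<Rightarrow> (nat \<Rightarrow> (real ^ 'n) set) \<Rightarrow> (nat \<Rightarrow> real ^ 'n) \<Rightarrow> (nat \<Rightarrow> real)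
   \<Rightarrow> (nat \<Rightarrow> nat \<Rightarrow> real ^ 'n)
   \<Rightarrow> (nat \<Rightarrow> nat \<Rightarrow> real ^ 'n option) \<Rightarrow> (nat \<Rightarrow> nat \<Rightarrow> real ^ 'n option)
   \<Rightarrow> (nat \<Rightarrow> nat \<Rightarrow> (real ^ 'n) set) \<Rightarrow> bool" where
  "cpm_run vstar P0 P c r \<alpha> xA xB Q \<longleftrightarrow>
     P 0 = P0 \<and>
     (\<forall>k. is_MEB (P k) (c k) (r k) \<and>
          orthonormal_basis (\<alpha> k) \<and>
          Q k 0 = P k \<and>
          (\<forall>i\<in>{1..CARD('n)}.
             is_query (\<alpha> k i) (c k) (xA k i) (xB k i) \<and>
             Q k i = Q k (i - 1) \<inter>
               {v. answer vstar (xA k i) (xB k i) * (recovery v \<bullet> (xA k i - xB k i)) \<le> 0}) \<and>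
          P (Suc k) = Q k (CARD('n)))"

end

theory Submission
  imports Defs
begin

text \<open>Relative to the center of the ball, one major iteration keeps only an orthant with respect to an
  orthonormal basis. The part of a ball of radius \<open>\<rho>\<close> in \<open>\<real>\<^sup>n\<close>, \<open>n \<ge> 2\<close>, that lies in such an orthant
  fits into the ball of radius \<open>sqrt ((n - 1) / n) * \<rho>\<close> around the point with all coordinates
  \<open>\<rho> / n\<close>. Hence the radii decay geometrically, and for \<open>k\<close> as assumed the diameter of \<open>P k\<close>
  is at most \<open>v_min vstar / n\<close>. As the true partworth is never cut off, no coordinate of
  \<open>recovery v\<close>, \<open>v \<in> P k\<close>, deviates from that of \<open>recovery vstar\<close> by more than \<open>v_min vstar\<close>,
  the last one being an affine combination of the \<open>n\<close> others.\<close>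

section \<open>Queries as half-spaces and expansion in orthonormal bases\<close>

lemma sum_option_UNIV:
  fixes f :: "'n::finite option \<Rightarrow> 'b::comm_monoid_add"
  shows "(\<Sum>i\<in>UNIV. f i) = f None + (\<Sum>j\<in>UNIV. f (Some j))"
  by (simp add: UNIV_option_conv sum.reindex)

text \<open>The entries of \<open>recovery v\<close> sum to 1, so the shift shared by all entries of
  \<open>xA - xB\<close> contributes the same constant for every \<open>v\<close>, namely
  \<open>- \<gamma> * (\<alpha> \<bullet> c)\<close>.\<close>

lemma is_query_separates:
  fixes \<alpha> c :: "real ^ 'n"
  assumes "is_query \<alpha> c xA xB"
  obtains \<gamma> where "\<gamma> > 0" "\<And>v. recovery v \<bullet> (xA - xB) = \<gamma> * (\<alpha> \<bullet> (v - c))"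
proof -
  obtain \<gamma> where "\<gamma> > 0" and N: "xA $ None - xB $ None = - \<gamma> * (\<alpha> \<bullet> c)"
    and S: "\<And>j. xA $ Some j - xB $ Some j = (xA $ None - xB $ None) + \<gamma> * \<alpha> $ j"
    using assms unfolding is_query_def by blast
  have "recovery v \<bullet> (xA - xB) = \<gamma> * (\<alpha> \<bullet> (v - c))" for v
  proof -
    define d where "d = xA $ None - xB $ None"
    have "recovery v \<bullet> (xA - xB) = (1 - (\<Sum>j\<in>UNIV. v $ j)) * d + (\<Sum>j\<in>UNIV. v $ j * (d + \<gamma> * \<alpha> $ j))"
      by (simp add: inner_vec_def sum_option_UNIV recovery_def S d_def)
    also have "(\<Sum>j\<in>UNIV. v $ j * (d + \<gamma> * \<alpha> $ j)) = (\<Sum>j\<in>UNIV. v $ j) * d + \<gamma> * (\<alpha> \<bullet> v)"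
      by (simp add: inner_vec_def sum_distrib_left sum_distrib_right sum.distrib algebra_simps)
    finally show ?thesis
      using N by (simp add: d_def inner_diff_right algebra_simps)
  qed
  with \<open>\<gamma> > 0\<close> show ?thesis using that by blast
qed

lemma orthonormal_basis_norm_sq:
  fixes \<alpha> :: "nat \<Rightarrow> real ^ 'n"
  assumes "orthonormal_basis \<alpha>"
  shows "(norm w)\<^sup>2 = (\<Sum>i\<in>{1..CARD('n)}. (\<alpha> i \<bullet> w)\<^sup>2)"
proof -
  let ?I = "{1..CARD('n)}"
  have on: "\<alpha> i \<bullet> \<alpha> j = (if i = j then 1 else 0)" if "i \<in> ?I" "j \<in> ?I" for i j
    using assms that unfolding orthonormal_basis_def by blast
  \<comment> \<open>Injectivity turns the expansion over the image set into a sum over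
    indices.\<close>
  have inj: "inj_on \<alpha> ?I"
    by (rule inj_onI) (metis on zero_neq_one)
  have "(\<Sum>b\<in>\<alpha> ` ?I. (w \<bullet> b) *\<^sub>R b) = w"
  proof (rule orthonormal_basis_expand)
    show "pairwise orthogonal (\<alpha> ` ?I)"
      using on by (fastforce simp: pairwise_def orthogonal_def)
    show "norm b = 1" if "b \<in> \<alpha> ` ?I" for b
      using that on by (auto simp: norm_eq_1)
    show "w \<in> span (\<alpha> ` ?I)"
      using assms by (simp add: orthonormal_basis_def)
  qed simp
  then have "w = (\<Sum>i\<in>?I. (\<alpha> i \<bullet> w) *\<^sub>R \<alpha> i)"
    using inj by (simp add: sum.reindex inner_commute)
  then have "w \<bullet> w = (\<Sum>i\<in>?I. (\<alpha> i \<bullet> w) *\<^sub>R \<alpha> i) \<bullet> w"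
    by (rule arg_cong)
  also have "\<dots> = (\<Sum>i\<in>?I. (\<alpha> i \<bullet> w)\<^sup>2)"
    by (simp add: inner_sum_left power2_eq_square)
  finally show ?thesis
    by (simp only: power2_norm_eq_inner)
qed

text \<open>With nonnegative coordinates in the basis, the coordinate sum
  \<open>d \<bullet> w\<close> is the 1-norm of \<open>w\<close> and hence at least
  \<open>norm w\<close>. This bounds the cross term of the expanded square and leaves a quadratic in
  \<open>norm w\<close>.\<close>

lemma orthant_ball_subset_cball:
  fixes \<beta> :: "nat \<Rightarrow> real ^ 'n"
  assumes n: "CARD('n) \<ge> 2" and \<beta>: "orthonormal_basis \<beta>" and "norm w \<le> \<rho>"
    and nonneg: "\<And>i. i \<in> {1..CARD('n)} \<Longrightarrow> \<beta> i \<bullet> w \<ge> 0"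
  shows "(norm (w - (\<rho> / CARD('n)) *\<^sub>R (\<Sum>i\<in>{1..CARD('n)}. \<beta> i)))\<^sup>2
           \<le> (real CARD('n) - 1) / real CARD('n) * \<rho>\<^sup>2"
proof -
  define m where "m = real CARD('n)"
  let ?I = "{1..CARD('n)}"
  define d where "d = (\<Sum>i\<in>?I. \<beta> i)"
  define s where "s = norm w"
  have "m \<ge> 2" using n by (simp add: m_def)
  have "0 \<le> s" "s \<le> \<rho>" using assms by (simp_all add: s_def)
  have d\<beta>: "d \<bullet> \<beta> j = 1" if "j \<in> ?I" for j
  proof -
    have "d \<bullet> \<beta> j = (\<Sum>i\<in>?I. if i = j then 1 else 0)"
      unfolding d_def inner_sum_left using \<beta> that
      by (intro sum.cong) (auto simp: orthonormal_basis_def)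
    then show ?thesis using that by simp
  qed
  have "d \<bullet> d = (\<Sum>i\<in>?I. d \<bullet> \<beta> i)"
    by (subst (2) d_def) (rule inner_sum_right)
  then have dd: "d \<bullet> d = m"
    using d\<beta> by (simp add: m_def)
  have "s\<^sup>2 = (\<Sum>i\<in>?I. (\<beta> i \<bullet> w)\<^sup>2)"
    unfolding s_def by (rule orthonormal_basis_norm_sq[OF \<beta>])
  also have "\<dots> \<le> (\<Sum>i\<in>?I. (\<beta> i \<bullet> w) * (d \<bullet> w))"
  proof (intro sum_mono)
    fix i assume "i \<in> ?I"
    then have "\<beta> i \<bullet> w \<le> d \<bullet> w"
      unfolding d_def inner_sum_left using nonneg by (intro member_le_sum) auto
    with nonneg \<open>i \<in> ?I\<close> show "(\<beta> i \<bullet> w)\<^sup>2 \<le> (\<beta> i \<bullet> w) * (d \<bullet> w)"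
      by (simp add: power2_eq_square mult_left_mono)
  qed
  also have "\<dots> = (d \<bullet> w)\<^sup>2"
    by (simp add: d_def inner_sum_left sum_distrib_right power2_eq_square)
  finally have "s\<^sup>2 \<le> (d \<bullet> w)\<^sup>2" .
  moreover have "0 \<le> d \<bullet> w"
    unfolding d_def inner_sum_left using nonneg by (intro sum_nonneg) auto
  ultimately have sd: "s \<le> d \<bullet> w"
    by (rule power2_le_imp_le)
  have "(norm (w - (\<rho> / m) *\<^sub>R d))\<^sup>2 = s\<^sup>2 - 2 * (\<rho> / m) * (d \<bullet> w) + (\<rho> / m)\<^sup>2 * m"
    unfolding s_def power2_norm_eq_inner inner_diff_left inner_diff_right
    by (simp add: dd inner_commute[of w d] power2_eq_square)
  also have "\<dots> \<le> s\<^sup>2 - 2 * (\<rho> / m) * s + (\<rho> / m)\<^sup>2 * m"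
    using sd \<open>0 \<le> s\<close> \<open>s \<le> \<rho>\<close> \<open>m \<ge> 2\<close> by (simp add: mult_left_mono divide_right_mono)
  also have "\<dots> \<le> (m - 1) / m * \<rho>\<^sup>2"
  proof -
    \<comment> \<open>The left-hand side is convex in \<open>s\<close>, so it suffices that the bound holds for \<open>s = 0\<close> and \<open>s = \<rho>\<close>;
      the difference is the sum of the two products below.\<close>
    have "0 \<le> m * s * (\<rho> - s) + (m - 2) * \<rho> * (\<rho> - s)"
      using \<open>0 \<le> s\<close> \<open>s \<le> \<rho>\<close> \<open>m \<ge> 2\<close> by (intro add_nonneg_nonneg mult_nonneg_nonneg) auto
    then have "m * s\<^sup>2 - 2 * \<rho> * s + \<rho>\<^sup>2 \<le> (m - 1) * \<rho>\<^sup>2"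
      by (simp add: power2_eq_square algebra_simps)
    then have "(m * s\<^sup>2 - 2 * \<rho> * s + \<rho>\<^sup>2) / m \<le> (m - 1) * \<rho>\<^sup>2 / m"
      using \<open>m \<ge> 2\<close> by (intro divide_right_mono) auto
    then show ?thesis
      using \<open>m \<ge> 2\<close> by (simp add: field_simps power2_eq_square)
  qed
  finally show ?thesis by (simp add: m_def d_def)
qed

section \<open>Contraction of the radii along a run\<close>

lemma answer_cases: "answer vstar xA xB = 1 \<or> answer vstar xA xB = -1"
  by (simp add: answer_def)

text \<open>A truthful answer selects a closed half-space containing \<open>vstar\<close>, ties
  included.\<close>

lemma answer_true: "answer vstar xA xB * (recovery vstar \<bullet> (xA - xB)) \<le> 0"
  by (simp add: answer_def utility_def inner_diff_right)

context
  fixes vstar :: "real ^ 'n" and P0 P c r \<alpha> xA xB Q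
  assumes run: "cpm_run vstar P0 P c r \<alpha> xA xB Q"
begin

text \<open>Eliminates the intermediate sets \<open>Q\<close>: later arguments see all cuts of one
  major iteration at once.\<close>

lemma cpm_run_P_Suc:
  "P (Suc k) = P k \<inter> {v. \<forall>i\<in>{1..CARD('n)}.
     answer vstar (xA k i) (xB k i) * (recovery v \<bullet> (xA k i - xB k i)) \<le> 0}"
proof -
  have "Q k m = P k \<inter> {v. \<forall>i\<in>{1..m}.
      answer vstar (xA k i) (xB k i) * (recovery v \<bullet> (xA k i - xB k i)) \<le> 0}"
    if "m \<le> CARD('n)" for m
    using that
  proof (induction m)
    case 0
    then show ?case using run by (simp add: cpm_run_def)
  next
    case (Suc m)
    have "Q k (Suc m) = Q k m \<inter> {v. answer vstar (xA k (Suc m)) (xB k (Suc m)) *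
        (recovery v \<bullet> (xA k (Suc m) - xB k (Suc m))) \<le> 0}"
      using run Suc.prems unfolding cpm_run_def
      by (metis Suc_eq_plus1 atLeastAtMost_iff diff_add_inverse2 le_add2)
    with Suc show ?case
      by (auto simp: atLeastAtMostSuc_conv)
  qed
  from this[of "CARD('n)"] show ?thesis using run by (simp add: cpm_run_def)
qed

lemma cpm_run_true_mem: "vstar \<in> P0 \<Longrightarrow> vstar \<in> P k"
proof (induction k)
  case 0
  then show ?case using run by (simp add: cpm_run_def)
next
  case (Suc k)
  then show ?case by (simp add: cpm_run_P_Suc answer_true)
qed

lemma cpm_run_MEB: "is_MEB (P k) (c k) (r k)"
  using run by (simp add: cpm_run_def)

lemma cpm_run_radius_Suc:
  assumes n: "CARD('n) \<ge> 2"
  shows "(r (Suc k))\<^sup>2 \<le> (real CARD('n) - 1) / real CARD('n) * (r k)\<^sup>2"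
proof -
  let ?I = "{1..CARD('n)}"
  define \<mu> where "\<mu> i = answer vstar (xA k i) (xB k i)" for i
  \<comment> \<open>Flipping signs according to the answers turns every cut into
    \<open>\<beta> i \<bullet> (v - c k) \<ge> 0\<close>, whatever the answers were.\<close>
  define \<beta> where "\<beta> i = - \<mu> i *\<^sub>R \<alpha> k i" for i
  have \<mu>: "\<mu> i = 1 \<or> \<mu> i = -1" for i
    using answer_cases by (simp add: \<mu>_def)
  have \<alpha>: "orthonormal_basis (\<alpha> k)"
    using run by (simp add: cpm_run_def)
  have "\<beta> i \<bullet> \<beta> j = (if i = j then 1 else 0)" if "i \<in> ?I" "j \<in> ?I" for i j
    using \<alpha> that \<mu>[of i] \<mu>[of j] by (auto simp: orthonormal_basis_def \<beta>_def)
  moreover have "\<alpha> k ` ?I \<subseteq> span (\<beta> ` ?I)"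
  proof (rule image_subsetI)
    fix i assume "i \<in> ?I"
    then have "- \<mu> i *\<^sub>R \<beta> i \<in> span (\<beta> ` ?I)"
      by (intro span_scale span_base imageI)
    moreover have "- \<mu> i *\<^sub>R \<beta> i = \<alpha> k i" using \<mu>[of i] by (auto simp: \<beta>_def)
    ultimately show "\<alpha> k i \<in> span (\<beta> ` ?I)" by simp
  qed
  then have "span (\<beta> ` ?I) = UNIV"
    using \<alpha> by (metis orthonormal_basis_def span_minimal subspace_span top.extremum_unique)
  ultimately have \<beta>: "orthonormal_basis \<beta>"
    by (simp add: orthonormal_basis_def)
  define d where "d = (r k / CARD('n)) *\<^sub>R (\<Sum>i\<in>?I. \<beta> i)"
  define q where "q = (real CARD('n) - 1) / real CARD('n) * (r k)\<^sup>2"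
  have "q \<ge> 0" using n by (simp add: q_def)
  have "P (Suc k) \<subseteq> cball (c k + d) (sqrt q)"
  proof
    fix v assume v: "v \<in> P (Suc k)"
    define w where "w = v - c k"
    have "v \<in> P k" using v by (simp add: cpm_run_P_Suc)
    then have "norm w \<le> r k"
      using cpm_run_MEB[of k] by (auto simp: is_MEB_def w_def dist_norm norm_minus_commute)
    moreover have "\<beta> i \<bullet> w \<ge> 0" if i: "i \<in> ?I" for i
    proof -
      have "is_query (\<alpha> k i) (c k) (xA k i) (xB k i)"
        using run i by (simp add: cpm_run_def)
      then obtain \<gamma> where "\<gamma> > 0"
        and g: "recovery v \<bullet> (xA k i - xB k i) = \<gamma> * (\<alpha> k i \<bullet> w)"
        unfolding w_def using is_query_separates by metis
      have "\<mu> i * (\<gamma> * (\<alpha> k i \<bullet> w)) \<le> 0"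
        using v i unfolding cpm_run_P_Suc \<mu>_def g[symmetric] by blast
      then have "\<gamma> * (\<beta> i \<bullet> w) \<ge> 0"
        by (simp add: \<beta>_def algebra_simps)
      with \<open>\<gamma> > 0\<close> show ?thesis by (simp add: zero_le_mult_iff)
    qed
    ultimately have "(norm (w - d))\<^sup>2 \<le> q"
      unfolding d_def q_def by (intro orthant_ball_subset_cball[OF n \<beta>]) auto
    then have "norm (w - d) \<le> sqrt q"
      by (rule real_le_rsqrt)
    then show "v \<in> cball (c k + d) (sqrt q)"
      by (simp add: w_def dist_norm norm_minus_commute algebra_simps)
  qed
  \<comment> \<open>Minimality of the enclosing ball, compared with the explicit ball around
    \<open>c k + d\<close>.\<close>
  then have "r (Suc k) \<le> sqrt q" and "0 \<le> r (Suc k)"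
    using cpm_run_MEB[of "Suc k"] \<open>q \<ge> 0\<close> by (auto simp: is_MEB_def)
  then have "(r (Suc k))\<^sup>2 \<le> (sqrt q)\<^sup>2"
    by (intro power_mono)
  with \<open>q \<ge> 0\<close> show ?thesis by (simp add: q_def)
qed

lemma cpm_run_radius:
  assumes n: "CARD('n) \<ge> 2"
  shows "(r k)\<^sup>2 \<le> ((real CARD('n) - 1) / real CARD('n)) ^ k * (r 0)\<^sup>2"
proof (induction k)
  case (Suc k)
  have "0 \<le> (real CARD('n) - 1) / real CARD('n)" using n by simp
  from mult_left_mono[OF Suc this] cpm_run_radius_Suc[OF n, of k] show ?case
    by (simp add: mult.assoc)
qed simp

end

section \<open>From small radii to the signs of the coordinates\<close>

lemma recovery_diff_le:
  fixes v w :: "real ^ 'n"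
  shows "\<bar>recovery v $ i - recovery w $ i\<bar> \<le> real CARD('n) * norm (v - w)"
proof (cases i)
  case None
  \<comment> \<open>The factor \<open>CARD('n)\<close> comes from this last coordinate, where the
    differences of all others add up.\<close>
  have "\<bar>recovery v $ i - recovery w $ i\<bar> = \<bar>\<Sum>j\<in>UNIV. (w - v) $ j\<bar>"
    by (simp add: recovery_def None sum_subtractf)
  also have "\<dots> \<le> (\<Sum>j\<in>UNIV. \<bar>(w - v) $ j\<bar>)"
    by (rule sum_abs)
  also have "\<dots> \<le> (\<Sum>j\<in>(UNIV::'n set). norm (v - w))"
    by (intro sum_mono) (metis component_le_norm_cart norm_minus_commute)
  finally show ?thesis by simp
next
  case (Some j)
  have "\<bar>recovery v $ i - recovery w $ i\<bar> = \<bar>(v - w) $ j\<bar>"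
    by (simp add: recovery_def Some)
  also have "\<dots> \<le> 1 * norm (v - w)"
    using component_le_norm_cart[of "v - w" j] by simp
  also have "\<dots> \<le> real CARD('n) * norm (v - w)"
    by (intro mult_right_mono) (auto simp: Suc_le_eq)
  finally show ?thesis .
qed

lemma v_min_le: "v_min v \<le> \<bar>recovery v $ i\<bar>"
  by (simp add: v_min_def)

lemma power_le_of_log_bound:
  fixes a b q :: real
  assumes "a > 0" "b > 0" "0 < q" "q < 1" and "real k \<ge> 2 * (ln a - ln b) / ln q"
  shows "q ^ k * b\<^sup>2 \<le> a\<^sup>2"
proof -
  have "ln q < 0" using assms by simp
  \<comment> \<open>Multiplying by the negative \<open>ln q\<close> reverses the inequality; what
    results is the logarithm of the claim.\<close>
  then have "real k * ln q \<le> 2 * (ln a - ln b)"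
    using assms(5) by (simp add: neg_divide_le_eq)
  then have "ln (q ^ k * b\<^sup>2) \<le> ln (a\<^sup>2)"
    using assms by (simp add: ln_mult ln_realpow)
  then show ?thesis using assms by simp
qed

theorem corollary3p2:
  fixes N :: nat
    and vstar :: "real ^ 'n"
    and P0 :: "(real ^ 'n) set"
    and P :: "nat \<Rightarrow> (real ^ 'n) set"
    and c :: "nat \<Rightarrow> real ^ 'n"
    and r :: "nat \<Rightarrow> real"
    and \<alpha> :: "nat \<Rightarrow> nat \<Rightarrow> real ^ 'n"
    and xA xB :: "nat \<Rightarrow> nat \<Rightarrow> real ^ 'n option"
    and Q :: "nat \<Rightarrow> nat \<Rightarrow> (real ^ 'n) set"
    and k :: nat
  assumes "N \<ge> 3" and "CARD('n) = N - 1"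
    and "polyhedron P0" and "bounded P0" and "vstar \<in> P0"
    and "cpm_run vstar P0 P c r \<alpha> xA xB Q"
    and "r 0 > 0"
    and "v_min vstar > 0"
    and "int k \<ge> \<lceil>2 * (ln (v_min vstar) - ln (2 * (real N - 1) * r 0)) /
                   (ln (real N - 2) - ln (real N - 1))\<rceil>"
  shows "\<forall>v \<in> P (Suc k). \<forall>i. recovery v $ i * recovery vstar $ i \<ge> 0"
proof (intro ballI allI)
  fix v i assume v: "v \<in> P (Suc k)"
  note run = assms(6)
  define m where "m = real CARD('n)"
  have n: "CARD('n) \<ge> 2" and mN: "m = real N - 1"
    using assms(1,2) by (auto simp: m_def of_nat_diff)
  have "m \<ge> 2" using n by (simp add: m_def)
  \<comment> \<open>The denominator of the iteration bound is the logarithm of the contraction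
    factor for squared radii, which also explains the 2 in its numerator.\<close>
  have "ln ((m - 1) / m) = ln (real N - 2) - ln (real N - 1)"
    using \<open>m \<ge> 2\<close> by (simp add: mN ln_div)
  then have "real k \<ge> 2 * (ln (v_min vstar) - ln (2 * m * r 0)) / ln ((m - 1) / m)"
    using assms(9) by (simp add: mN ceiling_le_iff)
  then have "((m - 1) / m) ^ k * (2 * m * r 0)\<^sup>2 \<le> (v_min vstar)\<^sup>2"
    using assms(7,8) \<open>m \<ge> 2\<close> by (intro power_le_of_log_bound) auto
  moreover have "(2 * m)\<^sup>2 * (r k)\<^sup>2 \<le> (2 * m)\<^sup>2 * (((m - 1) / m) ^ k * (r 0)\<^sup>2)"
    using cpm_run_radius[OF run n, of k] by (intro mult_left_mono) (auto simp: m_def)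
  ultimately have "(2 * m * r k)\<^sup>2 \<le> (v_min vstar)\<^sup>2"
    by (simp add: power_mult_distrib mult.commute mult.left_commute)
  then have rk: "2 * m * r k \<le> v_min vstar"
    by (rule power2_le_imp_le) (use assms(8) in simp)
  \<comment> \<open>The radius estimate is for index \<open>k\<close>; it reaches \<open>v\<close>
    because \<open>P (Suc k)\<close> is contained in \<open>P k\<close>.\<close>
  have "v \<in> cball (c k) (r k)" "vstar \<in> cball (c k) (r k)"
    using cpm_run_MEB[OF run, of k] v cpm_run_true_mem[OF run assms(5), of k]
    by (auto simp: is_MEB_def cpm_run_P_Suc[OF run])
  then have "norm (v - vstar) \<le> 2 * r k"
    unfolding mem_cball dist_norm by norm
  then have "m * norm (v - vstar) \<le> m * (2 * r k)"
    using \<open>m \<ge> 2\<close> by (intro mult_left_mono) auto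
  also have "\<dots> \<le> v_min vstar"
    using rk by (simp add: mult.left_commute)
  finally have "\<bar>recovery v $ i - recovery vstar $ i\<bar> \<le> v_min vstar"
    using recovery_diff_le[of v i vstar] by (simp add: m_def)
  also have "\<dots> \<le> \<bar>recovery vstar $ i\<bar>" by (rule v_min_le)
  \<comment> \<open>A number at distance at most \<open>\<bar>x\<bar>\<close> from \<open>x\<close>
    cannot have the opposite sign.\<close>
  finally show "recovery v $ i * recovery vstar $ i \<ge> 0"
    by (auto simp: zero_le_mult_iff abs_if split: if_splits)
qed

end
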